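(* Consider the system $x_{k+1}=A(p_k)x_k+Bu_k+w_k$ under the standing assumptions listed in the context, with the decomposition $x_k=z_k+e_k$, where $z_{k+1}=A_0z_k+Bv_k$, $z_0=x_0$ (so $e_0=0$), $u_k=Ke_k+v_k$, $K\in\mathbb{R}^{m\times n}$, and $v_k$ is a deterministic sequence. Then, for all $k\in\mathbb{N}$, the dynamics of the error covariance is given by the following equivalent expressions: $$\mathrm{cov}(e_{k+1})=(A_0+BK)\,\mathrm{cov}(e_k)\,(A_0+BK)^T+W+\mathrm{vec}^{-1}\Big(\mathbb{E}[\bar A(p_k)\otimes\bar A(p_k)]\,\mathrm{vec}\big(\mathrm{cov}(e_k)+z_kz_k^T\big)\Big),$$ and $$\epsilon_{k+1}=\Big((A_0+BK)\otimes(A_0+BK)+C_p\Big)\epsilon_k+C_p\zeta_k+\omega,$$ where $\epsilon_k=\mathrm{vec}(\mathrm{cov}(e_k))$, $\zeta_k=\mathrm{vec}(z_kz_k^T)$, $\omega=\mathrm{vec}(W)$ and $C_p=\mathbb{E}[\bar A(p_k)\otimes\bar A(p_k)]$.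
   Context: Setting and standing assumptions. The system is $x_{k+1}=A(p_k)x_k+Bu_k+w_k$ with state $x_k\in\mathbb{R}^n$, input $u_k\in\mathbb{R}^m$, $B\in\mathbb{R}^{n\times m}$ deterministic, and $x_0$ deterministic. The sequences $p=(p_k)_{k\in\mathbb{N}}$ ($l$-dimensional) and $w=(w_k)_{k\in\mathbb{N}}$ ($n$-dimensional) are stochastic i.i.d. sequences, with $\mathbb{E}[w_k]=0$ and $\mathrm{cov}(w_k)=\mathbb{E}[w_kw_k^T]=W\succ0$. The random matrix $A(p_k)\in\mathbb{R}^{n\times n}$ has entries with $\mathbb{E}[A_{i,j}(p_k)^2]<\infty$ for all $i,j$. Write $A(p_k)=A_0+\bar A(p_k)$ with $A_0=\mathbb{E}[A(p_k)]$, so $\mathbb{E}[\bar A(p_k)]=0$. The pair $(A_0,B)$ is stabilizable. For each $k$, the entries of $\bar A(p_k)$ are independent of the entries of $w_k$, and the pair $(\bar A(p_k),w_k)$ is independent of the state $x_k$ (hence of $e_k=x_k-z_k$, since $z_k$ is deterministic). With the decomposition and control law above, the error satisfies $e_{k+1}=(A(p_k)+BK)e_k+\bar A(p_k)z_k+w_k$, $e_0=0$. Notation: $\mathrm{cov}(v)=\mathbb{E}[(v-\mathbb{E}[v])(v-\mathbb{E}[v])^T]$ for a random vector $v$; $\otimes$ is the Kronecker product; $\mathrm{vec}$ is the (column-stacking) vectorization operator and $\mathrm{vec}^{-1}:\mathbb{R}^{n^2}\to\mathbb{R}^{n\times n}$ its inverse. *)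

theory Defs
  imports "HOL-Probability.Probability"
begin

definition outer :: "real ^ 'n \<Rightarrow> real ^ 'm \<Rightarrow> real ^ 'm ^ 'n" where
  "outer a b = (\<chi> i j. a $ i * b $ j)"

text \<open>
  Row and column indices of a Kronecker product are pairs (block index, index within the block);
  under the lexicographic order of pairs this is the usual block matrix.
\<close>

definition kron ::
  "real ^ 'b ^ 'a \<Rightarrow> real ^ 'd ^ 'c \<Rightarrow> real ^ ('b::finite \<times> 'd::finite) ^ ('a::finite \<times> 'c::finite)"
  where "kron P Q = (\<chi> r c. P $ fst r $ fst c * Q $ snd r $ snd c)"

text \<open>
  Column stacking: the entry in row i and column j of X is the i-th entry of the j-th block,
  i.e. it sits at position (j, i). With this ordering the vectorization of
  P ** X ** transpose Q is kron Q P *v vec_cols X, as checked below.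
\<close>

definition vec_cols :: "real ^ 'm ^ 'n \<Rightarrow> real ^ ('m::finite \<times> 'n::finite)" where
  "vec_cols X = (\<chi> s. X $ snd s $ fst s)"

definition unvec_cols :: "real ^ ('m::finite \<times> 'n::finite) \<Rightarrow> real ^ 'm ^ 'n" where
  "unvec_cols = inv vec_cols"

lemma bij_vec_cols: "bij vec_cols"
proof (rule o_bij)
  show "(\<lambda>y. \<chi> i j. y $ (j, i)) \<circ> vec_cols = id"
    by (simp add: vec_cols_def fun_eq_iff vec_eq_iff)
  show "vec_cols \<circ> (\<lambda>y. \<chi> i j. y $ (j, i)) = id"
    by (simp add: vec_cols_def fun_eq_iff vec_eq_iff)
qed

lemma vec_cols_unvec_cols [simp]: "vec_cols (unvec_cols y) = y"
  by (simp add: unvec_cols_def bij_vec_cols bij_is_surj surj_f_inv_f)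

lemma unvec_cols_vec_cols [simp]: "unvec_cols (vec_cols X) = X"
  by (simp add: unvec_cols_def bij_vec_cols bij_is_inj)

lemma unvec_cols_nth: "unvec_cols y $ i $ j = y $ (j, i)"
proof -
  have "unvec_cols y $ i $ j = vec_cols (unvec_cols y) $ (j, i)"
    by (simp add: vec_cols_def)
  then show ?thesis by simp
qed

lemma vec_cols_matrix_mult:
  fixes P :: "real ^ 'a ^ 'b" and X :: "real ^ 'c ^ 'a" and Q :: "real ^ 'c ^ 'd"
  shows "vec_cols (P ** X ** transpose Q) = kron Q P *v vec_cols X"
  by (simp add: vec_eq_iff vec_cols_def kron_def matrix_matrix_mult_def matrix_vector_mult_def
      transpose_def sum_distrib_left sum_distrib_right UNIV_Times_UNIV[symmetric] sum.cartesian_product'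
      mult_ac del: UNIV_Times_UNIV)

definition cov :: "'w measure \<Rightarrow> ('w \<Rightarrow> real ^ 'n) \<Rightarrow> real ^ 'n ^ 'n" where
  "cov M X = (let \<mu> = integral\<^sup>L M X in
     integral\<^sup>L M (\<lambda>\<omega>. outer (X \<omega> - \<mu>) (X \<omega> - \<mu>)))"

definition iid_seq :: "'w measure \<Rightarrow> (nat \<Rightarrow> 'w \<Rightarrow> 'a::topological_space) \<Rightarrow> bool" where
  "iid_seq M X \<longleftrightarrow> prob_space.indep_vars M (\<lambda>_. borel) X UNIV \<and>
     (\<forall>k. distr M borel (X k) = distr M borel (X 0))"

text \<open>
  The library's indep_var needs both random variables to have the same value type; this is the same
  notion for two value types.
\<close>

definition indep_rv ::
  "'w measure \<Rightarrow> ('w \<Rightarrow> 'a::topological_space) \<Rightarrow> ('w \<Rightarrow> 'b::topological_space) \<Rightarrow> bool"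
  where "indep_rv M X Y \<longleftrightarrow> X \<in> borel_measurable M \<and> Y \<in> borel_measurable M \<and>
     prob_space.indep_set M
       {X -` S \<inter> space M | S. S \<in> sets borel} {Y -` S \<inter> space M | S. S \<in> sets borel}"

lemma (in prob_space) indep_rv_iff_indep_var:
  "indep_rv M X Y \<longleftrightarrow> indep_var borel X borel Y"
proof -
  have *: "sigma_sets (space M) {Z -` S \<inter> space M | S. S \<in> sets borel}
      = {Z -` S \<inter> space M | S. S \<in> sets borel}" for Z :: "'a \<Rightarrow> 'b::topological_space"
    using sets_vimage_algebra[of "space M" Z borel] sets_vimage_algebra2[of Z "space M" borel]
    by simp
  show ?thesis
    unfolding indep_rv_def indep_var_eq * by blast
qed

definition pos_def :: "real ^ 'n ^ 'n \<Rightarrow> bool" where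
  "pos_def W \<longleftrightarrow> transpose W = W \<and> (\<forall>y. y \<noteq> 0 \<longrightarrow> y \<bullet> (W *v y) > 0)"

text \<open>Discrete-time stability: all complex eigenvalues lie in the open unit disc.\<close>

definition schur_stable :: "real ^ 'n ^ 'n \<Rightarrow> bool" where
  "schur_stable F \<longleftrightarrow> (\<forall>(c::complex) (y::complex ^ 'n).
     y \<noteq> 0 \<and> map_matrix of_real F *v y = c *s y \<longrightarrow> cmod c < 1)"

definition stabilizable :: "real ^ 'n ^ 'n \<Rightarrow> real ^ 'm ^ 'n \<Rightarrow> bool" where
  "stabilizable A B \<longleftrightarrow> (\<exists>G. schur_stable (A + B ** G))"

end

theory Submission
  imports Defs
begin

text \<open>
  With \<open>F = A\<^sub>0 + B ** K\<close> the error obeys \<open>e' = F *v e + Abar *v x + w\<close>. Expanding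
  \<open>e'\<close> times its transpose entrywise, independence of \<open>(Abar, w)\<close> from \<open>x = z + e\<close>
  factors every expectation; all cross terms contain one of the vanishing factors
  \<open>E[Abar]\<close>, \<open>E[w]\<close>, \<open>E[Abar w]\<close>, and the diagonal terms give the three summands.
\<close>

section \<open>Integrability of products and entrywise integration\<close>

text \<open>By the inequality 2|f g| \<le> f^2 + g^2, finite second moments dominate the product.
  This supplies integrability for the mixed second moments of the entries of \<open>Abar\<close>,
  \<open>w\<close> and \<open>e\<close>.\<close>

lemma integrable_mult_of_square_integrable:
  fixes f g :: "'w \<Rightarrow> real"
  assumes [measurable]: "f \<in> borel_measurable M" "g \<in> borel_measurable M"
    and f: "integrable M (\<lambda>\<omega>. (f \<omega>)\<^sup>2)" and g: "integrable M (\<lambda>\<omega>. (g \<omega>)\<^sup>2)"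
  shows "integrable M (\<lambda>\<omega>. f \<omega> * g \<omega>)"
proof (rule Bochner_Integration.integrable_bound)
  show "integrable M (\<lambda>\<omega>. (f \<omega>)\<^sup>2 + (g \<omega>)\<^sup>2)"
    using f g by simp
  have "norm (f \<omega> * g \<omega>) \<le> norm ((f \<omega>)\<^sup>2 + (g \<omega>)\<^sup>2)" for \<omega>
  proof -
    have "2 * (\<bar>f \<omega>\<bar> * \<bar>g \<omega>\<bar>) \<le> (f \<omega>)\<^sup>2 + (g \<omega>)\<^sup>2"
      using sum_squares_bound[of "\<bar>f \<omega>\<bar>" "\<bar>g \<omega>\<bar>"] by simp
    moreover have "0 \<le> \<bar>f \<omega>\<bar> * \<bar>g \<omega>\<bar>" by simp
    ultimately show ?thesis
      unfolding real_norm_def abs_mult by linarith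
  qed
  then show "AE \<omega> in M. norm (f \<omega> * g \<omega>) \<le> norm ((f \<omega>)\<^sup>2 + (g \<omega>)\<^sup>2)"
    by simp
qed simp

lemma borel_measurable_vec_nth:
  fixes f :: "'w \<Rightarrow> 'a::real_normed_vector ^ 'n"
  assumes "f \<in> borel_measurable M"
  shows "(\<lambda>\<omega>. f \<omega> $ i) \<in> borel_measurable M"
  by (rule borel_measurable_continuous_on[OF continuous_on_component[OF continuous_on_id] assms])

text \<open>A vector is the finite sum of its coordinates embedded along the axes, and each
  embedding is linear, hence bounded in finite dimension. The entry type is an arbitrary Euclidean
  space so that two applications cover matrices.\<close>

lemma integrable_vecI:
  fixes f :: "'w \<Rightarrow> 'a::euclidean_space ^ 'n"
  assumes "\<And>i. integrable M (\<lambda>\<omega>. f \<omega> $ i)"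
  shows "integrable M f"
proof -
  have "bounded_linear (axis i :: 'a \<Rightarrow> 'a ^ 'n)" for i
    unfolding linear_conv_bounded_linear[symmetric]
    by (rule linearI) (simp_all add: vec_eq_iff axis_def)
  from integrable_bounded_linear[OF this assms]
  have "integrable M (\<lambda>\<omega>. \<Sum>i\<in>UNIV. axis i (f \<omega> $ i))"
    by (rule Bochner_Integration.integrable_sum)
  moreover have "(\<Sum>i\<in>UNIV. axis i (f \<omega> $ i)) = f \<omega>" for \<omega>
    by (simp add: vec_eq_iff axis_def)
  ultimately show ?thesis by simp
qed

lemma has_bochner_integral_vecI:
  fixes f :: "'w \<Rightarrow> 'a::euclidean_space ^ 'n"
  assumes f: "\<And>i. has_bochner_integral M (\<lambda>\<omega>. f \<omega> $ i) (c $ i)"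
  shows "has_bochner_integral M f c"
proof -
  have int: "integrable M f"
    using f by (intro integrable_vecI) (auto simp: has_bochner_integral_iff)
  have "integral\<^sup>L M f $ i = c $ i" for i
    using integral_bounded_linear[OF bounded_linear_vec_nth int, of i] f[of i]
    by (simp add: has_bochner_integral_iff)
  with int show ?thesis
    by (simp add: has_bochner_integral_iff vec_eq_iff)
qed

lemma has_bochner_integral_vec_nth:
  fixes f :: "'w \<Rightarrow> 'a::euclidean_space ^ 'n"
  assumes "has_bochner_integral M f c"
  shows "has_bochner_integral M (\<lambda>\<omega>. f \<omega> $ i) (c $ i)"
  by (rule has_bochner_integral_bounded_linear[OF bounded_linear_vec_nth assms])

section \<open>Covariance of centred vectors as second moments\<close>

text \<open>Centring by a zero mean changes nothing, so the covariance is the matrix of second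
  moments and can be computed entry by entry.\<close>

lemma cov_eqI:
  assumes mean: "\<And>i. has_bochner_integral M (\<lambda>\<omega>. X \<omega> $ i) 0"
    and moment: "\<And>i j. has_bochner_integral M (\<lambda>\<omega>. X \<omega> $ i * X \<omega> $ j) (T $ i $ j)"
  shows "cov M X = T"
proof -
  have "integral\<^sup>L M X = 0"
    using has_bochner_integral_vecI[of M X 0] mean by (simp add: has_bochner_integral_iff)
  moreover have "has_bochner_integral M (\<lambda>\<omega>. outer (X \<omega>) (X \<omega>)) T"
    using moment by (intro has_bochner_integral_vecI) (simp add: outer_def)
  ultimately show ?thesis
    by (simp add: cov_def Let_def has_bochner_integral_iff)
qed

text \<open>Converse direction of \<open>cov_eqI\<close>: it reads second moments off a covariance.
  Square integrability guarantees that the entries are genuine expectations and not the default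
  value 0 of a non-integrable function.\<close>

lemma has_bochner_integral_cov:
  assumes mean: "\<And>i. has_bochner_integral M (\<lambda>\<omega>. X \<omega> $ i) 0"
    and square: "\<And>i. integrable M (\<lambda>\<omega>. (X \<omega> $ i)\<^sup>2)"
  shows "has_bochner_integral M (\<lambda>\<omega>. X \<omega> $ i * X \<omega> $ j) (cov M X $ i $ j)"
proof -
  define T where "T = (\<chi> i j. integral\<^sup>L M (\<lambda>\<omega>. X \<omega> $ i * X \<omega> $ j))"
  have meas: "(\<lambda>\<omega>. X \<omega> $ i) \<in> borel_measurable M" for i
    by (rule borel_measurable_has_bochner_integral[OF mean])
  have T: "has_bochner_integral M (\<lambda>\<omega>. X \<omega> $ i * X \<omega> $ j) (T $ i $ j)" for i j
    unfolding T_def vec_lambda_beta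
    by (rule has_bochner_integral_integrable)
       (rule integrable_mult_of_square_integrable[OF meas meas square square])
  have "cov M X = T"
    by (rule cov_eqI[OF mean T])
  with T show ?thesis by simp
qed

section \<open>Independence and factorization of expectations\<close>

lemma (in prob_space) indep_rv_compose:
  assumes XY: "indep_rv M X Y"
    and f: "f \<in> borel_measurable borel" and g: "g \<in> borel_measurable borel"
  shows "indep_rv M (\<lambda>\<omega>. f (X \<omega>)) (\<lambda>\<omega>. g (Y \<omega>))"
proof -
  have sub: "{(\<lambda>\<omega>. h (Z \<omega>)) -` S \<inter> space M | S. S \<in> sets borel}
      \<subseteq> {Z -` S \<inter> space M | S. S \<in> sets borel}"
    if h: "h \<in> borel_measurable borel"
    for h :: "'u::topological_space \<Rightarrow> 'v::topological_space" and Z :: "'a \<Rightarrow> 'u"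
  proof clarify
    fix S :: "'v set" assume "S \<in> sets borel"
    with h have "h -` S \<in> sets borel"
      using measurable_sets[OF h] by simp
    then show "\<exists>T. (\<lambda>\<omega>. h (Z \<omega>)) -` S \<inter> space M = Z -` T \<inter> space M \<and> T \<in> sets borel"
      by (intro exI[of _ "h -` S"]) auto
  qed
  have "f \<circ> X \<in> borel_measurable M" "g \<circ> Y \<in> borel_measurable M"
    using XY f g unfolding indep_rv_def by (blast intro: measurable_comp)+
  moreover have "indep_set {(\<lambda>\<omega>. f (X \<omega>)) -` S \<inter> space M | S. S \<in> sets borel}
      {(\<lambda>\<omega>. g (Y \<omega>)) -` S \<inter> space M | S. S \<in> sets borel}"
    using XY unfolding indep_rv_def indep_set_def
    by (elim conjE, elim indep_sets_mono_sets)
       (simp split: bool.split add: sub[OF f] sub[OF g])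
  ultimately show ?thesis
    by (simp add: indep_rv_def comp_def)
qed

text \<open>The variables \<open>X\<close> and \<open>Y\<close> may have different value types, but
  their images under \<open>f\<close> and \<open>g\<close> are both real and still independent, so
  the product rule for \<open>indep_var\<close> applies.\<close>

lemma (in prob_space) has_bochner_integral_indep_rv_mult:
  fixes f :: "'b::topological_space \<Rightarrow> real" and g :: "'c::topological_space \<Rightarrow> real"
  assumes XY: "indep_rv M X Y"
    and "f \<in> borel_measurable borel" "g \<in> borel_measurable borel"
    and f: "has_bochner_integral M (\<lambda>\<omega>. f (X \<omega>)) a"
    and g: "has_bochner_integral M (\<lambda>\<omega>. g (Y \<omega>)) b"
  shows "has_bochner_integral M (\<lambda>\<omega>. f (X \<omega>) * g (Y \<omega>)) (a * b)"
proof -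
  have ind: "indep_var borel (\<lambda>\<omega>. f (X \<omega>)) borel (\<lambda>\<omega>. g (Y \<omega>))"
    using indep_rv_compose[OF assms(1-3)] by (simp add: indep_rv_iff_indep_var)
  show ?thesis
    using indep_var_integrable[OF ind] indep_var_lebesgue_integral[OF ind] f g
    by (simp add: has_bochner_integral_iff)
qed

section \<open>One step of the recursion for the first two moments\<close>

text \<open>Here \<open>R\<close> plays the role of \<open>Abar k\<close>, \<open>Q i a j b\<close>
  is the mixed moment of its entries, and \<open>S\<close> is the second-moment matrix of the
  current error. Working with \<open>has_bochner_integral\<close> carries integrability along with
  the values, so the step can be iterated in an induction.\<close>

lemma (in prob_space) moments_step:
  fixes R :: "'a \<Rightarrow> real ^ 'n ^ 'n" and w x e e' :: "'a \<Rightarrow> real ^ 'n"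
  assumes indep: "indep_rv M (\<lambda>\<omega>. (R \<omega>, w \<omega>)) x"
    and R_mean: "\<And>i j. has_bochner_integral M (\<lambda>\<omega>. R \<omega> $ i $ j) 0"
    and R_moment: "\<And>i a j b. has_bochner_integral M (\<lambda>\<omega>. R \<omega> $ i $ a * R \<omega> $ j $ b) (Q i a j b)"
    and w_mean: "\<And>i. has_bochner_integral M (\<lambda>\<omega>. w \<omega> $ i) 0"
    and w_moment: "\<And>i j. has_bochner_integral M (\<lambda>\<omega>. w \<omega> $ i * w \<omega> $ j) (W $ i $ j)"
    and R_w: "\<And>i j r. has_bochner_integral M (\<lambda>\<omega>. R \<omega> $ i $ j * w \<omega> $ r) 0"
    and x: "\<And>\<omega>. \<omega> \<in> space M \<Longrightarrow> x \<omega> = z + e \<omega>"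
    and e_mean: "\<And>i. has_bochner_integral M (\<lambda>\<omega>. e \<omega> $ i) 0"
    and e_moment: "\<And>i j. has_bochner_integral M (\<lambda>\<omega>. e \<omega> $ i * e \<omega> $ j) (S $ i $ j)"
    and e': "\<And>\<omega>. \<omega> \<in> space M \<Longrightarrow> e' \<omega> = F *v e \<omega> + R \<omega> *v x \<omega> + w \<omega>"
  shows "has_bochner_integral M (\<lambda>\<omega>. e' \<omega> $ i) 0"
    and "has_bochner_integral M (\<lambda>\<omega>. e' \<omega> $ i * e' \<omega> $ j)
      ((F ** S ** transpose F) $ i $ j + W $ i $ j
        + (\<Sum>a\<in>UNIV. \<Sum>b\<in>UNIV. Q i a j b * (S $ a $ b + z $ a * z $ b)))"
proof -
  have one: "has_bochner_integral M (\<lambda>_. c) c" for c :: real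
    by (simp add: has_bochner_integral_iff prob_space)
  have x_mean: "has_bochner_integral M (\<lambda>\<omega>. x \<omega> $ a) (z $ a)" for a
    using has_bochner_integral_add[OF one[of "z $ a"] e_mean[of a]]
    by (subst has_bochner_integral_cong[OF refl _ refl, where g = "\<lambda>\<omega>. z $ a + e \<omega> $ a"])
       (auto simp: x)
  have xx: "has_bochner_integral M (\<lambda>\<omega>. x \<omega> $ a * x \<omega> $ b) (S $ a $ b + z $ a * z $ b)" for a b
  proof (subst has_bochner_integral_cong[OF refl _ refl])
    show "x \<omega> $ a * x \<omega> $ b = e \<omega> $ a * e \<omega> $ b + z $ a * z $ b + z $ a * e \<omega> $ b + z $ b * e \<omega> $ a"
      if "\<omega> \<in> space M" for \<omega>
      using x[OF that] by (simp add: algebra_simps)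
    show "has_bochner_integral M
        (\<lambda>\<omega>. e \<omega> $ a * e \<omega> $ b + z $ a * z $ b + z $ a * e \<omega> $ b + z $ b * e \<omega> $ a)
        (S $ a $ b + z $ a * z $ b)"
      using has_bochner_integral_add[OF has_bochner_integral_add[OF has_bochner_integral_add
          [OF e_moment one] has_bochner_integral_mult_right[OF e_mean]]
          has_bochner_integral_mult_right[OF e_mean], of a b "z $ a * z $ b" "z $ a" b "z $ b" a]
      by simp
  qed
  \<comment> \<open>All uses of independence go through this fact. Since \<open>f\<close> acts on
    the whole pair, it can select entries of \<open>R\<close>, entries of \<open>w\<close>, or
    products of both; each choice is continuous and hence measurable.\<close>
  have factor: "has_bochner_integral M (\<lambda>\<omega>. f (R \<omega>, w \<omega>) * g (x \<omega>)) (s * t)"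
    if "f \<in> borel_measurable borel" "g \<in> borel_measurable borel"
      "has_bochner_integral M (\<lambda>\<omega>. f (R \<omega>, w \<omega>)) s" "has_bochner_integral M (\<lambda>\<omega>. g (x \<omega>)) t"
    for f :: "(real ^ 'n ^ 'n) \<times> (real ^ 'n) \<Rightarrow> real" and g s t
    using has_bochner_integral_indep_rv_mult[OF indep that] by simp
  have cont: "f \<in> borel_measurable borel" if "continuous_on UNIV f" for f :: "'u::topological_space \<Rightarrow> real"
    using that by (rule borel_measurable_continuous_onI)
  have Rx: "has_bochner_integral M (\<lambda>\<omega>. R \<omega> $ i $ a * x \<omega> $ a) 0" for i a
    using factor[of "\<lambda>(r, _). r $ i $ a" "\<lambda>y. y $ a" 0 "z $ a", OF cont cont] R_mean x_mean
    by (simp add: case_prod_beta continuous_intros)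
  have RxRx: "has_bochner_integral M (\<lambda>\<omega>. (R \<omega> $ i $ a * R \<omega> $ j $ b) * (x \<omega> $ a * x \<omega> $ b))
      (Q i a j b * (S $ a $ b + z $ a * z $ b))" for i a j b
    using factor[of "\<lambda>(r, _). r $ i $ a * r $ j $ b" "\<lambda>y. y $ a * y $ b" "Q i a j b" "S $ a $ b + z $ a * z $ b", OF cont cont] R_moment xx
    by (simp add: case_prod_beta continuous_intros)
  \<comment> \<open>Joint independence of the pair from \<open>x\<close> is what allows
    \<open>R\<close> and \<open>w\<close> to be kept together in one factor, whose mean is 0 by
    \<open>R_w\<close>.\<close>
  have Rxw: "has_bochner_integral M (\<lambda>\<omega>. (R \<omega> $ i $ a * w \<omega> $ j) * x \<omega> $ a) 0" for i a j
    using factor[of "\<lambda>(r, v). r $ i $ a * v $ j" "\<lambda>y. y $ a" 0 "z $ a", OF cont cont] R_w x_mean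
    by (simp add: case_prod_beta continuous_intros)
  \<comment> \<open>Independence is stated against \<open>x\<close>, so \<open>e\<close> is replaced
    by \<open>x - z\<close> with \<open>z\<close> constant. Both resulting terms vanish because
    \<open>R\<close> has mean 0. The product of \<open>e\<close> and \<open>w\<close> below is
    treated in the same way.\<close>
  have eRx: "has_bochner_integral M (\<lambda>\<omega>. e \<omega> $ c * (R \<omega> $ i $ a * x \<omega> $ a)) 0" for c i a
  proof (subst has_bochner_integral_cong[OF refl _ refl])
    show "e \<omega> $ c * (R \<omega> $ i $ a * x \<omega> $ a)
        = R \<omega> $ i $ a * (x \<omega> $ c * x \<omega> $ a) + - z $ c * (R \<omega> $ i $ a * x \<omega> $ a)"
      if "\<omega> \<in> space M" for \<omega>
      using x[OF that] by (simp add: algebra_simps)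
    have "has_bochner_integral M (\<lambda>\<omega>. R \<omega> $ i $ a * (x \<omega> $ c * x \<omega> $ a)) 0"
      using factor[of "\<lambda>(r, _). r $ i $ a" "\<lambda>y. y $ c * y $ a" 0 "S $ c $ a + z $ c * z $ a", OF cont cont] R_mean xx
      by (simp add: case_prod_beta continuous_intros)
    moreover have "has_bochner_integral M (\<lambda>\<omega>. - z $ c * (R \<omega> $ i $ a * x \<omega> $ a)) (- z $ c * 0)"
      by (intro has_bochner_integral_mult_right Rx)
    ultimately show "has_bochner_integral M (\<lambda>\<omega>. R \<omega> $ i $ a * (x \<omega> $ c * x \<omega> $ a)
        + - z $ c * (R \<omega> $ i $ a * x \<omega> $ a)) 0"
      using has_bochner_integral_add by fastforce
  qed
  have ew: "has_bochner_integral M (\<lambda>\<omega>. e \<omega> $ c * w \<omega> $ j) 0" for c j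
  proof (subst has_bochner_integral_cong[OF refl _ refl])
    show "e \<omega> $ c * w \<omega> $ j = w \<omega> $ j * x \<omega> $ c + - z $ c * w \<omega> $ j" if "\<omega> \<in> space M" for \<omega>
      using x[OF that] by (simp add: algebra_simps)
    have "has_bochner_integral M (\<lambda>\<omega>. w \<omega> $ j * x \<omega> $ c) 0"
      using factor[of "\<lambda>(_, v). v $ j" "\<lambda>y. y $ c" 0 "z $ c", OF cont cont] w_mean x_mean
      by (simp add: case_prod_beta continuous_intros)
    moreover have "has_bochner_integral M (\<lambda>\<omega>. - z $ c * w \<omega> $ j) (- z $ c * 0)"
      by (intro has_bochner_integral_mult_right w_mean)
    ultimately show "has_bochner_integral M (\<lambda>\<omega>. w \<omega> $ j * x \<omega> $ c + - z $ c * w \<omega> $ j) 0"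
      using has_bochner_integral_add by fastforce
  qed
  \<comment> \<open>Row \<open>i\<close> of \<open>e'\<close> splits into the propagated error
    \<open>f\<close>, the multiplicative noise \<open>r\<close> and the additive noise
    \<open>w\<close>.\<close>
  define f r where "f i \<omega> = (\<Sum>a\<in>UNIV. F $ i $ a * e \<omega> $ a)"
    and "r i \<omega> = (\<Sum>a\<in>UNIV. R \<omega> $ i $ a * x \<omega> $ a)" for i \<omega>
  have e'_nth: "e' \<omega> $ i = f i \<omega> + r i \<omega> + w \<omega> $ i" if "\<omega> \<in> space M" for i \<omega>
    by (simp add: e'[OF that] f_def r_def matrix_vector_mult_def)
  have f_mean: "has_bochner_integral M (f i) 0" and r_mean: "has_bochner_integral M (r i) 0" for i
    using has_bochner_integral_sum[of UNIV M "\<lambda>a \<omega>. F $ i $ a * e \<omega> $ a" "\<lambda>_. 0"]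
      has_bochner_integral_sum[of UNIV M "\<lambda>a \<omega>. R \<omega> $ i $ a * x \<omega> $ a" "\<lambda>_. 0"]
      has_bochner_integral_mult_right[OF e_mean] Rx
    by (auto simp: f_def[abs_def] r_def[abs_def])
  show "has_bochner_integral M (\<lambda>\<omega>. e' \<omega> $ i) 0"
    using has_bochner_integral_add[OF has_bochner_integral_add[OF f_mean r_mean] w_mean, of i i i]
    by (subst has_bochner_integral_cong[OF refl e'_nth refl]) auto
  have ff: "has_bochner_integral M (\<lambda>\<omega>. f i \<omega> * f j \<omega>) ((F ** S ** transpose F) $ i $ j)"
  proof -
    \<comment> \<open>The column index \<open>b\<close> is summed on the outside because the
      left-nested product \<open>F ** S ** transpose F\<close> unfolds in this order.\<close>
    have "has_bochner_integral M
        (\<lambda>\<omega>. \<Sum>b\<in>UNIV. \<Sum>a\<in>UNIV. F $ i $ a * F $ j $ b * (e \<omega> $ a * e \<omega> $ b))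
        (\<Sum>b\<in>UNIV. \<Sum>a\<in>UNIV. F $ i $ a * F $ j $ b * S $ a $ b)"
      by (intro has_bochner_integral_sum has_bochner_integral_mult_right e_moment)
    moreover have "f i \<omega> * f j \<omega>
        = (\<Sum>b\<in>UNIV. \<Sum>a\<in>UNIV. F $ i $ a * F $ j $ b * (e \<omega> $ a * e \<omega> $ b))" for \<omega>
      unfolding f_def sum_product by (subst sum.swap) (simp add: ac_simps)
    moreover have "(F ** S ** transpose F) $ i $ j
        = (\<Sum>b\<in>UNIV. \<Sum>a\<in>UNIV. F $ i $ a * F $ j $ b * S $ a $ b)"
      by (simp add: matrix_matrix_mult_def transpose_def sum_distrib_left sum_distrib_right ac_simps)
    ultimately show ?thesis by simp
  qed
  have fr: "has_bochner_integral M (\<lambda>\<omega>. f i \<omega> * r j \<omega>) 0" for i j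
  proof -
    have "has_bochner_integral M
        (\<lambda>\<omega>. \<Sum>a\<in>UNIV. \<Sum>b\<in>UNIV. F $ i $ a * (e \<omega> $ a * (R \<omega> $ j $ b * x \<omega> $ b)))
        (\<Sum>a\<in>UNIV. \<Sum>b\<in>(UNIV :: 'n set). F $ i $ a * 0)"
      by (intro has_bochner_integral_sum has_bochner_integral_mult_right eRx)
    then show ?thesis
      by (simp add: f_def r_def sum_product ac_simps)
  qed
  have fw: "has_bochner_integral M (\<lambda>\<omega>. f i \<omega> * w \<omega> $ j) 0" for i j
  proof -
    have "has_bochner_integral M (\<lambda>\<omega>. \<Sum>a\<in>UNIV. F $ i $ a * (e \<omega> $ a * w \<omega> $ j))
        (\<Sum>a\<in>UNIV. F $ i $ a * 0)"
      by (intro has_bochner_integral_sum has_bochner_integral_mult_right ew)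
    then show ?thesis
      by (simp add: f_def sum_distrib_left sum_distrib_right ac_simps)
  qed
  have rr: "has_bochner_integral M (\<lambda>\<omega>. r i \<omega> * r j \<omega>)
      (\<Sum>a\<in>UNIV. \<Sum>b\<in>UNIV. Q i a j b * (S $ a $ b + z $ a * z $ b))"
  proof -
    have "has_bochner_integral M
        (\<lambda>\<omega>. \<Sum>a\<in>UNIV. \<Sum>b\<in>UNIV. (R \<omega> $ i $ a * R \<omega> $ j $ b) * (x \<omega> $ a * x \<omega> $ b))
        (\<Sum>a\<in>UNIV. \<Sum>b\<in>UNIV. Q i a j b * (S $ a $ b + z $ a * z $ b))"
      by (intro has_bochner_integral_sum RxRx)
    then show ?thesis
      by (simp add: r_def sum_product ac_simps)
  qed
  have rw: "has_bochner_integral M (\<lambda>\<omega>. r i \<omega> * w \<omega> $ j) 0" for i j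
  proof -
    have "has_bochner_integral M (\<lambda>\<omega>. \<Sum>a\<in>UNIV. (R \<omega> $ i $ a * w \<omega> $ j) * x \<omega> $ a)
        (\<Sum>a\<in>(UNIV::'n set). 0)"
      by (intro has_bochner_integral_sum Rxw)
    then show ?thesis
      by (simp add: r_def sum_distrib_left sum_distrib_right ac_simps)
  qed
  show "has_bochner_integral M (\<lambda>\<omega>. e' \<omega> $ i * e' \<omega> $ j)
      ((F ** S ** transpose F) $ i $ j + W $ i $ j
        + (\<Sum>a\<in>UNIV. \<Sum>b\<in>UNIV. Q i a j b * (S $ a $ b + z $ a * z $ b)))" (is "has_bochner_integral M _ ?T")
  proof (subst has_bochner_integral_cong[OF refl _ refl])
    \<comment> \<open>Of the nine products, the three diagonal ones give \<open>?T\<close> and the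
      six cross terms, grouped in pairs, give 0. The value
      \<open>?T + (0 + 0) + (0 + 0) + (0 + 0)\<close> mirrors the grouping of the integrand so that
      additivity applies summand by summand.\<close>
    have "has_bochner_integral M
      (\<lambda>\<omega>. f i \<omega> * f j \<omega> + w \<omega> $ i * w \<omega> $ j + r i \<omega> * r j \<omega>
        + (f i \<omega> * r j \<omega> + f i \<omega> * w \<omega> $ j) + (f j \<omega> * r i \<omega> + f j \<omega> * w \<omega> $ i)
        + (r i \<omega> * w \<omega> $ j + r j \<omega> * w \<omega> $ i)) (?T + (0 + 0) + (0 + 0) + (0 + 0))"
      by (intro has_bochner_integral_add ff w_moment rr fr fw rw)
    then show "has_bochner_integral M
      (\<lambda>\<omega>. f i \<omega> * f j \<omega> + w \<omega> $ i * w \<omega> $ j + r i \<omega> * r j \<omega>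
        + (f i \<omega> * r j \<omega> + f i \<omega> * w \<omega> $ j) + (f j \<omega> * r i \<omega> + f j \<omega> * w \<omega> $ i)
        + (r i \<omega> * w \<omega> $ j + r j \<omega> * w \<omega> $ i)) ?T"
      by simp
    show "e' \<omega> $ i * e' \<omega> $ j = f i \<omega> * f j \<omega> + w \<omega> $ i * w \<omega> $ j + r i \<omega> * r j \<omega>
        + (f i \<omega> * r j \<omega> + f i \<omega> * w \<omega> $ j) + (f j \<omega> * r i \<omega> + f j \<omega> * w \<omega> $ i)
        + (r i \<omega> * w \<omega> $ j + r j \<omega> * w \<omega> $ i)" if "\<omega> \<in> space M" for \<omega>
      by (simp add: e'_nth[OF that] algebra_simps)
  qed
qed

section \<open>Dynamics of the error covariance\<close>

theorem proposition1:
  fixes M :: "'w measure"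
    and p :: "nat \<Rightarrow> 'w \<Rightarrow> real ^ 'l"
    and w x e :: "nat \<Rightarrow> 'w \<Rightarrow> real ^ 'n"
    and u :: "nat \<Rightarrow> 'w \<Rightarrow> real ^ 'm"
    and z :: "nat \<Rightarrow> real ^ 'n"
    and v :: "nat \<Rightarrow> real ^ 'm"
    and x\<^sub>0 :: "real ^ 'n"
    and A :: "real ^ 'l \<Rightarrow> real ^ 'n ^ 'n"
    and A\<^sub>0 W :: "real ^ 'n ^ 'n"
    and Abar :: "nat \<Rightarrow> 'w \<Rightarrow> real ^ 'n ^ 'n"
    and B :: "real ^ 'm ^ 'n"
    and K :: "real ^ 'n ^ 'm"
    and C\<^sub>p :: "real ^ ('n \<times> 'n) ^ ('n \<times> 'n)"
    and \<epsilon> \<zeta> :: "nat \<Rightarrow> real ^ ('n \<times> 'n)"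
    and \<omega>\<^sub>W :: "real ^ ('n \<times> 'n)"
  assumes "prob_space M"
    and p_iid: "iid_seq M p"
    and w_iid: "iid_seq M w"
    and w_square_integrable: "\<And>k i. integrable M (\<lambda>\<omega>. (w k \<omega> $ i)\<^sup>2)"
    and w_mean: "\<And>k. integral\<^sup>L M (w k) = 0"
    and w_cov: "\<And>k. cov M (w k) = W"
    and W_pos: "pos_def W"
    and A_measurable: "A \<in> borel_measurable borel"
    and A_square_integrable: "\<And>k i j. integrable M (\<lambda>\<omega>. (A (p k \<omega>) $ i $ j)\<^sup>2)"
    and A0: "A\<^sub>0 = integral\<^sup>L M (\<lambda>\<omega>. A (p 0 \<omega>))"
    and Abar: "Abar = (\<lambda>k \<omega>. A (p k \<omega>) - A\<^sub>0)"
    and stabilizable: "stabilizable A\<^sub>0 B"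
    and Abar_w_indep: "\<And>k i j r. prob_space.indep_var M
          borel (\<lambda>\<omega>. Abar k \<omega> $ i $ j) borel (\<lambda>\<omega>. w k \<omega> $ r)"
    and Abar_w_x_indep: "\<And>k. indep_rv M (\<lambda>\<omega>. (Abar k \<omega>, w k \<omega>)) (x k)"
    and x_init: "\<And>\<omega>. \<omega> \<in> space M \<Longrightarrow> x 0 \<omega> = x\<^sub>0"
    and x_step: "\<And>k \<omega>. \<omega> \<in> space M \<Longrightarrow>
          x (Suc k) \<omega> = A (p k \<omega>) *v x k \<omega> + B *v u k \<omega> + w k \<omega>"
    and z_init: "z 0 = x\<^sub>0"
    and z_step: "\<And>k. z (Suc k) = A\<^sub>0 *v z k + B *v v k"
    and decomposition: "\<And>k \<omega>. \<omega> \<in> space M \<Longrightarrow> x k \<omega> = z k + e k \<omega>"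
    and control: "\<And>k \<omega>. \<omega> \<in> space M \<Longrightarrow> u k \<omega> = K *v e k \<omega> + v k"
    and Cp: "C\<^sub>p = integral\<^sup>L M (\<lambda>\<omega>. kron (Abar 0 \<omega>) (Abar 0 \<omega>))"
    and \<epsilon>: "\<epsilon> = (\<lambda>k. vec_cols (cov M (e k)))"
    and \<zeta>: "\<zeta> = (\<lambda>k. vec_cols (outer (z k) (z k)))"
    and \<omega>\<^sub>W: "\<omega>\<^sub>W = vec_cols W"
  shows "\<forall>k.
     cov M (e (Suc k)) =
       (A\<^sub>0 + B ** K) ** cov M (e k) ** transpose (A\<^sub>0 + B ** K) + W
       + unvec_cols (integral\<^sup>L M (\<lambda>\<omega>. kron (Abar k \<omega>) (Abar k \<omega>))
           *v vec_cols (cov M (e k) + outer (z k) (z k)))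
   \<and> \<epsilon> (Suc k) = (kron (A\<^sub>0 + B ** K) (A\<^sub>0 + B ** K) + C\<^sub>p) *v \<epsilon> k + C\<^sub>p *v \<zeta> k + \<omega>\<^sub>W"
proof -
  interpret prob_space M by fact
  define F where "F = A\<^sub>0 + B ** K"
  have p_meas [measurable]: "p k \<in> borel_measurable M" for k
    using p_iid by (auto simp: iid_seq_def indep_vars_def2)
  have w_meas: "w k \<in> borel_measurable M" for k
    using w_iid by (auto simp: iid_seq_def indep_vars_def2)
  have A_nth [measurable]: "(\<lambda>y. A y $ i $ j) \<in> borel_measurable borel" for i j
    by (intro borel_measurable_vec_nth A_measurable)
  \<comment> \<open>Both \<open>A\<^sub>0\<close> and \<open>C\<^sub>p\<close> are defined by
    expectations at time 0; identical distribution of the \<open>p k\<close> makes them valid at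
    every time.\<close>
  have same_law: "integral\<^sup>L M (\<lambda>\<omega>. h (p k \<omega>)) = integral\<^sup>L M (\<lambda>\<omega>. h (p 0 \<omega>))"
    if [measurable]: "h \<in> borel_measurable borel" for k and h :: "real ^ 'l \<Rightarrow> real"
  proof -
    have "integral\<^sup>L (distr M borel (p k)) h = integral\<^sup>L (distr M borel (p 0)) h"
      using p_iid by (metis iid_seq_def)
    then show ?thesis by (simp add: integral_distr)
  qed
  have A_int: "integrable M (\<lambda>\<omega>. A (p k \<omega>) $ i $ j)" for k i j
    by (rule square_integrable_imp_integrable[OF _ A_square_integrable]) measurable
  have "A\<^sub>0 $ i $ j = integral\<^sup>L M (\<lambda>\<omega>. A (p 0 \<omega>) $ i $ j)" for i j
  proof -
    have "has_bochner_integral M (\<lambda>\<omega>. A (p 0 \<omega>)) A\<^sub>0"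
      unfolding A0 by (intro has_bochner_integral_integrable integrable_vecI A_int)
    from has_bochner_integral_vec_nth[OF has_bochner_integral_vec_nth[OF this]] show ?thesis
      by (simp add: has_bochner_integral_iff)
  qed
  then have A_mean: "integral\<^sup>L M (\<lambda>\<omega>. A (p k \<omega>) $ i $ j) = A\<^sub>0 $ i $ j" for k i j
    using same_law[OF A_nth] by simp
  have R_mean: "has_bochner_integral M (\<lambda>\<omega>. Abar k \<omega> $ i $ j) 0" for k i j
    using A_int[of k i j] by (simp add: Abar has_bochner_integral_iff A_mean prob_space)
  have R_square: "integrable M (\<lambda>\<omega>. (Abar k \<omega> $ i $ j)\<^sup>2)" for k i j
    using A_int[of k i j] A_square_integrable[of k i j] by (simp add: Abar power2_diff)
  \<comment> \<open>Entrywise form of \<open>C\<^sub>p\<close>, with the index convention of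
    \<open>kron\<close>. The Kronecker expectation at each time \<open>k\<close> is shown to equal
    this one matrix.\<close>
  define C where "C = (\<chi> r c. integral\<^sup>L M (\<lambda>\<omega>. Abar 0 \<omega> $ fst r $ fst c * Abar 0 \<omega> $ snd r $ snd c))"
  have RR: "has_bochner_integral M (\<lambda>\<omega>. Abar k \<omega> $ i $ a * Abar k \<omega> $ j $ b) (C $ (i, j) $ (a, b))"
    for k i a j b
  proof -
    have "integrable M (\<lambda>\<omega>. Abar k \<omega> $ i $ a * Abar k \<omega> $ j $ b)"
      by (intro integrable_mult_of_square_integrable R_square borel_measurable_has_bochner_integral[OF R_mean])
    moreover have "(\<lambda>y. (A y - A\<^sub>0) $ i $ a * (A y - A\<^sub>0) $ j $ b) \<in> borel_measurable borel"
      by simp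
    note same_law[OF this, of k]
    ultimately show ?thesis
      by (simp add: has_bochner_integral_iff C_def Abar)
  qed
  have "has_bochner_integral M (\<lambda>\<omega>. kron (Abar k \<omega>) (Abar k \<omega>)) C" for k
    using RR[of k] by (intro has_bochner_integral_vecI) (auto simp: kron_def)
  then have kron_mean: "integral\<^sup>L M (\<lambda>\<omega>. kron (Abar k \<omega>) (Abar k \<omega>)) = C" for k
    by (simp add: has_bochner_integral_iff)
  have w_int: "integrable M (\<lambda>\<omega>. w k \<omega> $ i)" for k i
    by (rule square_integrable_imp_integrable[OF borel_measurable_vec_nth[OF w_meas] w_square_integrable])
  have w_hbi: "has_bochner_integral M (\<lambda>\<omega>. w k \<omega> $ i) 0" for k i
    using has_bochner_integral_vec_nth[OF has_bochner_integral_integrable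
        [OF integrable_vecI[OF w_int]], of k i]
    by (simp add: w_mean)
  have w_moment: "has_bochner_integral M (\<lambda>\<omega>. w k \<omega> $ i * w k \<omega> $ j) (W $ i $ j)" for k i j
    using has_bochner_integral_cov[OF w_hbi w_square_integrable] by (simp add: w_cov)
  have R_w: "has_bochner_integral M (\<lambda>\<omega>. Abar k \<omega> $ i $ j * w k \<omega> $ r) 0" for k i j r
    using indep_var_integrable[OF Abar_w_indep[of k i j r]]
      indep_var_lebesgue_integral[OF Abar_w_indep[of k i j r]] R_mean[of k i j] w_hbi[of k r]
    by (simp add: has_bochner_integral_iff)
  \<comment> \<open>The terms in \<open>A\<^sub>0 *v z k\<close> and \<open>B *v v k\<close> cancel.
    Leaving \<open>Abar k\<close> applied to the whole state, instead of splitting it over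
    \<open>z k\<close> and \<open>e k\<close>, keeps a factor known to be independent of it.\<close>
  have e_step: "e (Suc k) \<omega> = F *v e k \<omega> + Abar k \<omega> *v x k \<omega> + w k \<omega>" if \<omega>: "\<omega> \<in> space M" for k \<omega>
  proof -
    have "e (Suc k) \<omega> = A (p k \<omega>) *v x k \<omega> + B *v u k \<omega> + w k \<omega> - z (Suc k)"
      using x_step[OF \<omega>, of k] decomposition[OF \<omega>, of "Suc k"] by (metis add_diff_cancel_left')
    also have "\<dots> = F *v e k \<omega> + Abar k \<omega> *v x k \<omega> + w k \<omega>"
      by (simp add: z_step control[OF \<omega>] decomposition[OF \<omega>] F_def Abar
          matrix_vector_right_distrib matrix_vector_mult_add_rdistrib
          matrix_vector_mult_diff_rdistrib matrix_vector_mul_assoc algebra_simps)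
    finally show ?thesis .
  qed
  \<comment> \<open>Column stacking puts entry (i, j) at position (j, i), so the moments are indexed
    in swapped order; commuting the two factors justifies the swap.\<close>
  have R_moment: "has_bochner_integral M (\<lambda>\<omega>. Abar k \<omega> $ i $ a * Abar k \<omega> $ j $ b) (C $ (j, i) $ (b, a))"
    for k i a j b
    using RR[of k j b i a] by (simp add: mult.commute)
  have step: "has_bochner_integral M (\<lambda>\<omega>. e (Suc k) \<omega> $ i) 0"
    "has_bochner_integral M (\<lambda>\<omega>. e (Suc k) \<omega> $ i * e (Suc k) \<omega> $ j)
      ((F ** cov M (e k) ** transpose F) $ i $ j + W $ i $ j
        + (\<Sum>a\<in>UNIV. \<Sum>b\<in>UNIV. C $ (j, i) $ (b, a) * (cov M (e k) $ a $ b + z k $ a * z k $ b)))"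
    if "\<And>i. has_bochner_integral M (\<lambda>\<omega>. e k \<omega> $ i) 0"
      "\<And>i. integrable M (\<lambda>\<omega>. (e k \<omega> $ i)\<^sup>2)"
    for k i j
    by (rule moments_step[OF Abar_w_x_indep R_mean R_moment w_hbi w_moment R_w decomposition
          that(1) has_bochner_integral_cov[OF that] e_step]; assumption?)+
  \<comment> \<open>These are exactly the premises of \<open>step\<close>. They start from
    \<open>e 0 = 0\<close>, since \<open>z\<close> and \<open>x\<close> have the same initial value,
    and square integrability is inherited from the diagonal second moments.\<close>
  have e_moments: "(\<forall>i. has_bochner_integral M (\<lambda>\<omega>. e k \<omega> $ i) 0)
      \<and> (\<forall>i. integrable M (\<lambda>\<omega>. (e k \<omega> $ i)\<^sup>2))" for k
  proof (induction k)
    case 0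
    have "e 0 \<omega> = 0" if "\<omega> \<in> space M" for \<omega>
      using decomposition[OF that, of 0] x_init[OF that] z_init by simp
    then show ?case
      by (simp add: has_bochner_integral_zero cong: has_bochner_integral_cong Bochner_Integration.integrable_cong)
  next
    case (Suc k)
    then have "has_bochner_integral M (\<lambda>\<omega>. e (Suc k) \<omega> $ i) 0"
      and "integrable M (\<lambda>\<omega>. e (Suc k) \<omega> $ i * e (Suc k) \<omega> $ i)" for i
      using step(1)[of k i] step(2)[of k i i] by (auto simp: has_bochner_integral_iff)
    then show ?case
      by (simp add: power2_eq_square)
  qed
  have cov_step: "cov M (e (Suc k)) = F ** cov M (e k) ** transpose F + W
      + unvec_cols (C *v vec_cols (cov M (e k) + outer (z k) (z k)))" for k
  proof (rule cov_eqI)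
    have "unvec_cols (C *v vec_cols (cov M (e k) + outer (z k) (z k))) $ i $ j
        = (\<Sum>a\<in>UNIV. \<Sum>b\<in>UNIV. C $ (j, i) $ (b, a) * (cov M (e k) $ a $ b + z k $ a * z k $ b))"
      for i j
      \<comment> \<open>The sum over stacked positions (b, a) has \<open>b\<close> outermost,
        whereas the moment formula has \<open>a\<close> outermost.\<close>
      by (subst sum.swap)
        (simp add: unvec_cols_nth matrix_vector_mult_def vec_cols_def outer_def
          UNIV_Times_UNIV[symmetric] sum.cartesian_product' del: UNIV_Times_UNIV)
    then show "has_bochner_integral M (\<lambda>\<omega>. e (Suc k) \<omega> $ i * e (Suc k) \<omega> $ j)
        ((F ** cov M (e k) ** transpose F + W
          + unvec_cols (C *v vec_cols (cov M (e k) + outer (z k) (z k)))) $ i $ j)" for i j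
      using step(2)[of k i j] e_moments[of k] by simp
  qed (use e_moments in blast)
  have vec_cols_add: "vec_cols (X + Y) = vec_cols X + vec_cols Y" for X Y :: "real ^ 'n ^ 'n"
    by (simp add: vec_cols_def vec_eq_iff)
  \<comment> \<open>Vectorizing \<open>cov_step\<close>: \<open>vec_cols\<close> is additive, turns
    the congruence by \<open>F\<close> into \<open>kron F F\<close>, and cancels
    \<open>unvec_cols\<close>; the action of \<open>C\<close> then splits over the covariance and
    the outer product.\<close>
  have "\<epsilon> (Suc k) = (kron F F + C) *v \<epsilon> k + C *v \<zeta> k + \<omega>\<^sub>W" for k
    by (simp add: \<epsilon> \<zeta> \<omega>\<^sub>W cov_step vec_cols_add vec_cols_matrix_mult
        matrix_vector_right_distrib matrix_vector_mult_add_rdistrib)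
  with cov_step show ?thesis
    by (simp add: kron_mean Cp flip: F_def)
qed

end
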